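(* Let $n$ and $m$ be positive integers with $m > 1$ and $n$ even. Then $$S_n(m) \equiv m\,B_n \equiv - \sum_{\substack{p \mid m \\ p-1 \mid n}} \frac{m}{p} \pmod{m},$$ where the sum runs over all primes $p$ such that $p$ divides $m$ and $p-1$ divides $n$.
   Context: The Bernoulli numbers $B_n$ are the rational numbers defined by $\frac{z}{e^z-1} = \sum_{n=0}^\infty B_n \frac{z^n}{n!}$ for $|z|<2\pi$ (so $B_0=1$, $B_1=-\tfrac12$, $B_2=\tfrac16$, $B_4=-\tfrac1{30}$). For positive integers $n,m$, $S_n(m) = \sum_{k=1}^{m-1} k^n$. Congruences between rational numbers are understood as follows: $a \equiv b \pmod m$ means that $a-b$, written in lowest terms, has denominator coprime to $m$ and numerator divisible by $m$. An empty sum is $0$. *)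

theory Defs
  imports
    "HOL-Complex_Analysis.Complex_Analysis"
    "HOL-Computational_Algebra.Computational_Algebra"
begin

text \<open>
  The Bernoulli numbers are read off the generating function \<open>z / (e^z - 1)\<close>, taken as a
  formal power series over the rationals; \<open>fps_exp 1 - 1\<close> has subdegree 1, so the quotient
  is the exact one. Theorem \<open>bernoulli_sums\<close> below gives the analytic form of the definition.
\<close>

definition bernoulli :: "nat \<Rightarrow> rat" where
  "bernoulli n = fact n * fps_nth (fps_X / (fps_exp 1 - 1)) n"

definition power_sum :: "nat \<Rightarrow> nat \<Rightarrow> nat" where
  "power_sum n m = (\<Sum>k\<in>{1..m - 1}. k ^ n)"

text \<open>\<open>quotient_of r\<close> is the pair (numerator, denominator) of \<open>r\<close> in lowest terms.\<close>

definition rat_cong :: "rat \<Rightarrow> rat \<Rightarrow> nat \<Rightarrow> bool" where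
  "rat_cong a b m \<longleftrightarrow>
     coprime (snd (quotient_of (a - b))) (int m) \<and> int m dvd fst (quotient_of (a - b))"

lemma fps_exp_minus_1:
  "fps_exp 1 - 1 \<noteq> (0 :: 'a :: field_char_0 fps)"
  "subdegree (fps_exp 1 - 1 :: 'a :: field_char_0 fps) = 1"
proof -
  show *: "subdegree (fps_exp 1 - 1 :: 'a fps) = 1"
    by (rule subdegreeI) auto
  show "fps_exp 1 - 1 \<noteq> (0 :: 'a fps)"
    using * by force
qed

lemma bernoulli_fps_mult:
  "fps_X / (fps_exp 1 - 1) * (fps_exp 1 - 1) = (fps_X :: 'a :: field_char_0 fps)"
proof (rule dvd_div_mult_self)
  show "fps_exp 1 - 1 dvd (fps_X :: 'a fps)"
    by (subst fps_dvd_iff [OF fps_exp_minus_1(1)])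
       (simp_all only: fps_exp_minus_1(2) subdegree_fps_X fps_X_neq_zero not_False_eq_True order_refl)
qed

lemma of_rat_fact: "of_rat (fact k) = (fact k :: 'a :: field_char_0)"
  by (metis of_nat_fact of_rat_of_nat_eq)

lemma bernoulli_fps_of_rat:
  "Abs_fps (\<lambda>n. of_rat (bernoulli n) / fact n) =
     (fps_X / (fps_exp 1 - 1) :: 'a :: field_char_0 fps)"
proof -
  let ?F = "fps_X / (fps_exp 1 - 1) :: rat fps"
  let ?G = "Abs_fps (\<lambda>n. of_rat (fps_nth ?F n)) :: 'a fps"
  have "?G * (fps_exp 1 - 1) = fps_X"
  proof (rule fps_ext)
    fix n
    have e: "fps_nth (fps_exp 1 - 1 :: 'a fps) k = of_rat (fps_nth (fps_exp 1 - 1) k)" for k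
      by (auto simp: of_rat_divide of_rat_diff of_rat_fact)
    have "fps_nth (?G * (fps_exp 1 - 1)) n = of_rat (fps_nth (?F * (fps_exp 1 - 1)) n)"
      by (simp only: fps_mult_nth e of_rat_sum of_rat_mult fps_nth_Abs_fps)
    also have "\<dots> = of_rat (fps_nth fps_X n)"
      by (simp only: bernoulli_fps_mult)
    also have "\<dots> = fps_nth fps_X n"
      by simp
    finally show "fps_nth (?G * (fps_exp 1 - 1)) n = fps_nth fps_X n" .
  qed
  also have "\<dots> = fps_X / (fps_exp 1 - 1) * (fps_exp 1 - 1 :: 'a fps)"
    by (rule bernoulli_fps_mult [symmetric])
  finally have "?G = fps_X / (fps_exp 1 - 1)"
    using fps_exp_minus_1(1) mult_right_cancel by blast
  moreover have "?G = Abs_fps (\<lambda>n. of_rat (bernoulli n) / fact n)"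
    by (simp add: bernoulli_def of_rat_mult of_rat_fact)
  ultimately show ?thesis by simp
qed

lemma exp_neq_1:
  assumes "z \<noteq> 0" "norm z < 2 * pi"
  shows "exp z \<noteq> (1 :: complex)"
proof
  assume "exp z = 1"
  then obtain n :: int where n: "Re z = 0" "Im z = of_int (2 * n) * pi"
    by (auto simp: exp_eq_1)
  hence "n \<noteq> 0" using assms(1) by (auto simp: complex_eq_iff)
  hence "1 * pi \<le> \<bar>of_int n\<bar> * pi"
    by (intro mult_right_mono) (auto simp: abs_if)
  moreover have "\<bar>Im z\<bar> = 2 * (\<bar>of_int n\<bar> * pi)"
    using n by (simp add: abs_mult)
  ultimately show False using assms(2) abs_Im_le_cmod [of z] by linarith
qed

theorem bernoulli_sums:
  fixes z :: complex
  assumes "z \<noteq> 0" "norm z < 2 * pi"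
  shows "(\<lambda>n. of_rat (bernoulli n) * z ^ n / fact n) sums (z / (exp z - 1))"
proof -
  let ?F = "fps_X / (fps_exp 1 - 1) :: complex fps"
  define f :: "complex \<Rightarrow> complex" where "f = (\<lambda>z. if z = 0 then 1 else z / (exp z - 1))"
  have exp: "f has_fps_expansion ?F"
    unfolding f_def
  proof (rule has_fps_expansion_divide)
    show "(\<lambda>z. z) has_fps_expansion (fps_X :: complex fps)"
      by (rule has_fps_expansion_fps_X)
    show "(\<lambda>z. exp z - 1) has_fps_expansion (fps_exp 1 - 1 :: complex fps)"
      by (intro fps_expansion_intros)
    show "subdegree (fps_exp 1 - 1 :: complex fps) \<le> subdegree (fps_X :: complex fps)"
      by (simp only: fps_exp_minus_1(2) subdegree_fps_X)
    show "(1 :: complex) = fps_nth fps_X (subdegree (fps_exp 1 - 1 :: complex fps)) /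
                fps_nth (fps_exp 1 - 1) (subdegree (fps_exp 1 - 1 :: complex fps))"
      unfolding fps_exp_minus_1(2) by simp
  qed (rule fps_exp_minus_1)
  have cont: "isCont f 0"
    using has_fps_expansion_imp_continuous [OF exp] .
  have "(\<lambda>z. z / (exp z - 1)) holomorphic_on ball 0 (2 * pi) - {0}"
    using exp_neq_1 by (intro holomorphic_intros) auto
  hence "f holomorphic_on ball 0 (2 * pi) - {0}"
    by (rule holomorphic_transform) (auto simp: f_def)
  hence holo: "f holomorphic_on ball 0 (2 * pi)"
  proof (rule no_isolated_singularity' [rotated])
    fix w assume "w \<in> {0 :: complex}"
    thus "(f \<longlongrightarrow> f w) (at w within ball 0 (2 * pi))"
      using cont by (auto simp: isCont_def intro: tendsto_within_subset)
  qed auto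
  hence holo': "f holomorphic_on eball 0 (ereal (2 * pi))" by simp
  have F: "fps_expansion f 0 = ?F"
    using exp by (rule fps_expansion_eqI)
  have "ereal (norm z) < ereal (2 * pi)" using assms(2) by simp
  also have "\<dots> \<le> fps_conv_radius ?F"
    using conv_radius_fps_expansion [OF holo'] unfolding F .
  finally have "ereal (norm z) < fps_conv_radius ?F" .
  hence "(\<lambda>n. fps_nth ?F n * z ^ n) sums eval_fps ?F z"
    by (rule sums_eval_fps)
  moreover have "eval_fps ?F z = f z"
    by (rule has_fps_expansion_imp_eval_fps_eq [OF exp assms(2) holo])
  moreover have "fps_nth ?F n = of_rat (bernoulli n) / fact n" for n
    by (simp only: bernoulli_fps_of_rat [symmetric] fps_nth_Abs_fps)
  ultimately have "(\<lambda>n. of_rat (bernoulli n) / fact n * z ^ n) sums f z"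
    by simp
  thus ?thesis using assms(1) by (simp add: f_def)
qed

end

theory Submission
  imports Defs "HOL-Number_Theory.Number_Theory"
begin

text \<open>
  Expanding \<open>(e^(mx) - 1) / (e^x - 1)\<close> gives Faulhaber's formula
  \<open>S_n(m) = (\<Sum>k\<le>n. (n choose k) B_(n-k) m^(k+1) / (k+1))\<close>. Fix a prime \<open>p\<close> dividing \<open>m\<close>.
  Taking \<open>m = p\<close>, induction on \<open>n\<close> shows that \<open>p B_n\<close> is \<open>p\<close>-integral. Then, for even \<open>n\<close>,
  all terms with \<open>k \<ge> 1\<close> remain \<open>p\<close>-integral after division by \<open>m\<close>, which is the first
  congruence. Its case \<open>m = p\<close>, together with the value of \<open>S_n(p)\<close> modulo \<open>p\<close>, shows that
  \<open>B_n + 1/p\<close> (if \<open>p - 1\<close> divides \<open>n\<close>) or \<open>B_n\<close> (otherwise) is \<open>p\<close>-integral, and the second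
  congruence follows.
\<close>

subsection \<open>Rational numbers integral at a prime\<close>

text \<open>Membership in the localization of the integers at \<open>p\<close>. The fraction need
  not be in lowest terms, so closure under sums and products only multiplies denominators and uses
  that \<open>p\<close> is prime.\<close>

definition p_integral :: "nat \<Rightarrow> rat \<Rightarrow> bool" where
  "p_integral p x \<longleftrightarrow> (\<exists>a b :: int. \<not> int p dvd b \<and> x = of_int a / of_int b)"

lemma p_integralI: "\<not> int p dvd b \<Longrightarrow> x = of_int a / of_int b \<Longrightarrow> p_integral p x"
  unfolding p_integral_def by blast

lemma p_integral_of_int: "prime p \<Longrightarrow> p_integral p (of_int a)"
  by (rule p_integralI [of p 1 _ a]) (auto dest: prime_gt_1_nat)

lemma p_integral_of_nat: "prime p \<Longrightarrow> p_integral p (of_nat a)"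
  using p_integral_of_int [of p "int a"] by simp

lemma p_integral_add:
  assumes "prime p" "p_integral p x" "p_integral p y"
  shows "p_integral p (x + y)"
proof -
  obtain a b c d where *: "\<not> int p dvd b" "x = of_int a / of_int b"
      "\<not> int p dvd d" "y = of_int c / of_int d"
    using assms(2,3) unfolding p_integral_def by blast
  hence "b \<noteq> 0" "d \<noteq> 0" by auto
  thus ?thesis using * assms(1)
    by (intro p_integralI [of p "b * d" _ "a * d + c * b"])
       (auto simp: prime_dvd_mult_iff add_frac_eq)
qed

lemma p_integral_mult:
  assumes "prime p" "p_integral p x" "p_integral p y"
  shows "p_integral p (x * y)"
proof -
  obtain a b c d where *: "\<not> int p dvd b" "x = of_int a / of_int b"
      "\<not> int p dvd d" "y = of_int c / of_int d"
    using assms(2,3) unfolding p_integral_def by blast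
  thus ?thesis using assms(1)
    by (intro p_integralI [of p "b * d" _ "a * c"]) (auto simp: prime_dvd_mult_iff)
qed

lemma p_integral_minus:
  assumes "prime p" "p_integral p x"
  shows "p_integral p (- x)"
  using p_integral_mult [OF assms(1) p_integral_of_int [OF assms(1), of "-1"] assms(2)] by simp

lemma p_integral_diff:
  assumes "prime p" "p_integral p x" "p_integral p y"
  shows "p_integral p (x - y)"
  using p_integral_add [OF assms(1,2) p_integral_minus [OF assms(1,3)]] by simp

lemma p_integral_sum:
  assumes "prime p" "\<And>i. i \<in> A \<Longrightarrow> p_integral p (f i)"
  shows "p_integral p (\<Sum>i\<in>A. f i)"
  using assms(2)
proof (induction A rule: infinite_finite_induct)
  case (insert i A)
  thus ?case by (simp add: p_integral_add [OF assms(1)])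
qed (use p_integral_of_int [OF assms(1), of 0] in auto)

text \<open>Local-global principle: integrality of the quotient at each prime dividing
  \<open>m\<close> makes its reduced denominator \<open>t\<close> coprime to \<open>m\<close>, and
  this passes to the numerator and denominator of \<open>a - b\<close>.\<close>

lemma rat_congI:
  assumes "m > 0" and int: "\<And>p. prime p \<Longrightarrow> p dvd m \<Longrightarrow> p_integral p ((a - b) / of_nat m)"
  shows "rat_cong a b m"
proof -
  obtain u v where uv: "quotient_of (a - b) = (u, v)" by fastforce
  obtain s t where st: "quotient_of ((a - b) / of_nat m) = (s, t)" by fastforce
  note cop = quotient_of_coprime [OF uv] quotient_of_coprime [OF st]
  have pos: "v > 0" "t > 0" using quotient_of_denom_pos [OF uv] quotient_of_denom_pos [OF st] by simp_all
  have t: "coprime t (int m)"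
  proof (rule ccontr)
    assume "\<not> coprime t (int m)"
    hence "\<not> is_unit (gcd t (int m))" by (simp add: coprime_iff_gcd_eq_1)
    moreover have "gcd t (int m) \<noteq> 0" using pos by simp
    ultimately obtain q where "q dvd gcd t (int m)" "prime q"
      using prime_divisor_exists [of "gcd t (int m)"] by auto
    hence q: "prime q" "q dvd t" "q dvd int m" by auto
    define p where "p = nat q"
    have p: "q = int p" "prime p"
      using q(1) prime_ge_0_int [of q] prime_nat_int_transfer [of p] by (simp_all add: p_def)
    obtain c d where cd: "\<not> int p dvd d" "(a - b) / of_nat m = of_int c / of_int d"
      using int [OF p(2)] q(3) unfolding p_integral_def p(1) by auto
    have "d \<noteq> 0" using cd by auto
    have "of_int s / of_int t = (of_int c / of_int d :: rat)"
      using quotient_of_div [OF st] cd(2) by simp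
    hence "of_int (s * d) = (of_int (c * t) :: rat)"
      using \<open>d \<noteq> 0\<close> pos by (simp add: frac_eq_eq)
    hence "s * d = c * t" by (simp only: of_int_eq_iff)
    hence "int p dvd s * d" using q(2) p(1) by simp
    hence "int p dvd s" using cd(1) p(2) by (simp add: prime_dvd_mult_iff)
    thus False using coprime_common_divisor [OF cop(2), of q] q(1,2) p(1) not_prime_unit by blast
  qed
  have "of_int u / of_int v / of_nat m = (of_int s / of_int t :: rat)"
    using quotient_of_div [OF uv] quotient_of_div [OF st] by simp
  hence "of_int (u * t) = (of_int (s * int m * v) :: rat)"
    using pos \<open>m > 0\<close> by (simp add: field_simps)
  hence eq: "u * t = s * int m * v" by (simp only: of_int_eq_iff)
  \<comment> \<open>In \<open>u * t = s * int m * v\<close>, \<open>t\<close> is coprime to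
    \<open>m\<close> and \<open>v\<close> to \<open>u\<close>; so \<open>m\<close> divides
    \<open>u\<close>, while \<open>v\<close> divides \<open>t\<close> and inherits its coprimality
    to \<open>m\<close>.\<close>
  have "int m dvd u * t" unfolding eq by simp
  hence "int m dvd u" using t by (simp add: coprime_dvd_mult_left_iff coprime_commute [of "int m"])
  moreover have "v dvd u * t" unfolding eq by simp
  hence "v dvd t" using cop(1) by (simp add: coprime_dvd_mult_right_iff coprime_commute [of v])
  hence "coprime v (int m)" using t by (rule coprime_divisors [OF _ dvd_refl])
  ultimately show ?thesis by (simp add: rat_cong_def uv)
qed

text \<open>If \<open>p ^ e\<close> is the exact power of \<open>p\<close> in \<open>Suc k\<close>,
  then 2^e \<le> \<open>Suc k\<close> \<le> j + 2 < 2^(j+1), whence e \<le> j. The case k = j + 1 is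
  allowed because one factor \<open>p\<close> will be spent on a Bernoulli number.\<close>

lemma p_integral_power_div:
  assumes p: "prime p" and "j + 1 \<ge> k" "k \<ge> 1" "j \<ge> 1"
  shows "p_integral p (of_nat p ^ j / of_nat (Suc k))"
proof -
  obtain c where c: "Suc k = p ^ multiplicity p (Suc k) * c" "\<not> p dvd c"
    using multiplicity_decompose' [of "Suc k" p] p by (metis Suc_neq_Zero not_prime_unit)
  define e where "e = multiplicity p (Suc k)"
  have "c > 0" using c by (intro Nat.gr0I) auto
  have "e \<le> j"
  proof (rule ccontr)
    assume "\<not> e \<le> j"
    hence "2 ^ (j + 1) \<le> (2 :: nat) ^ e" by (intro power_increasing) auto
    also have "\<dots> \<le> p ^ e" using prime_ge_2_nat [OF p] by (intro power_mono) auto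
    also have "\<dots> \<le> Suc k" unfolding e_def using c by (metis dvd_imp_le dvd_triv_left zero_less_Suc)
    also have "\<dots> \<le> j + 2" using assms by simp
    finally have "2 ^ (j + 1) \<le> j + 2" .
    moreover have "j + 2 < 2 ^ (j + 1)" using \<open>j \<ge> 1\<close>
      by (induction j rule: dec_induct) auto
    ultimately show False by simp
  qed
  hence pow: "(of_nat p ^ j :: rat) = of_nat p ^ e * of_nat p ^ (j - e)"
    by (simp flip: power_add)
  have "(of_nat (Suc k) :: rat) = of_nat p ^ e * of_nat c"
    using c(1) unfolding e_def [symmetric] by (metis of_nat_mult of_nat_power)
  moreover have "(of_nat p :: rat) \<noteq> 0" using prime_gt_0_nat [OF p] by simp
  ultimately have "(of_nat p ^ j / of_nat (Suc k) :: rat) = of_int (int p ^ (j - e)) / of_int (int c)"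
    unfolding pow by simp
  moreover have "\<not> int p dvd int c" using c(2) by simp
  ultimately show ?thesis by (intro p_integralI)
qed

subsection \<open>Faulhaber's formula\<close>

text \<open>A telescoping geometric sum with ratio e^x.\<close>

lemma sum_fps_exp_mult:
  "(\<Sum>j<m. fps_exp (of_nat j)) * (fps_exp 1 - 1) = (fps_exp (of_nat m) - 1 :: 'a :: field_char_0 fps)"
  by (induction m) (simp_all add: algebra_simps fps_exp_add_mult)

text \<open>Multiply the geometric sum by x, write x as \<open>?F\<close> times e^x - 1, cancel e^x
  - 1 and compare coefficients of x^(n+1). Starting at j = 0 with 0^0 = 1 makes the formula hold for
  n = 0 too.\<close>

lemma faulhaber:
  "of_nat (\<Sum>j<m. j ^ n) =
     (\<Sum>k\<le>n. of_nat (n choose k) * bernoulli (n - k) * of_nat m ^ Suc k / of_nat (Suc k))"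
proof -
  let ?F = "fps_X / (fps_exp 1 - 1) :: rat fps"
  let ?E = "\<Sum>j<m. fps_exp (of_nat j) :: rat fps"
  have F: "fps_nth ?F i = bernoulli i / fact i" for i
    by (simp add: bernoulli_def)
  have "(?E * fps_X) * (fps_exp 1 - 1) = fps_X * (fps_exp (of_nat m) - 1)"
    unfolding sum_fps_exp_mult [symmetric] by (simp only: mult_ac)
  also have "\<dots> = (?F * (fps_exp 1 - 1)) * (fps_exp (of_nat m) - 1)"
    by (simp only: bernoulli_fps_mult)
  also have "\<dots> = ((fps_exp (of_nat m) - 1) * ?F) * (fps_exp 1 - 1)"
    by (simp only: mult_ac)
  finally have eq: "?E * fps_X = (fps_exp (of_nat m) - 1) * ?F"
    using fps_exp_minus_1(1) mult_right_cancel by blast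
  have "of_nat (\<Sum>j<m. j ^ n) / fact n = fps_nth ?E n"
    by (simp add: fps_sum_nth sum_divide_distrib)
  also have "\<dots> = fps_nth (?E * fps_X) (Suc n)"
    by simp
  also have "\<dots> = (\<Sum>i=0..Suc n. fps_nth (fps_exp (of_nat m) - 1) i * fps_nth ?F (Suc n - i))"
    by (simp only: eq fps_mult_nth)
  \<comment> \<open>The constant term of e^(mx) - 1 vanishes, so the index shifts to i =
    \<open>Suc k\<close>.\<close>
  also have "\<dots> = (\<Sum>k\<le>n. of_nat m ^ Suc k / fact (Suc k) * (bernoulli (n - k) / fact (n - k)))"
    unfolding sum.atLeast0_atMost_Suc_shift
    by (simp add: atLeast0AtMost F del: fact_Suc power_Suc)
  also have "\<dots> = (\<Sum>k\<le>n. of_nat (n choose k) * bernoulli (n - k) * of_nat m ^ Suc k /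
                      of_nat (Suc k) / fact n)"
    by (intro sum.cong refl) (simp add: binomial_fact mult_ac del: of_nat_Suc)
  finally show ?thesis
    by (simp only: sum_divide_distrib [symmetric] divide_cancel_right fact_nonzero simp_thms)
qed

lemma power_sum_eq: "n > 0 \<Longrightarrow> power_sum n m = (\<Sum>j<m. j ^ n)"
  unfolding power_sum_def by (rule sum.mono_neutral_left) (auto simp: Suc_le_eq)

lemma faulhaber_tail:
  "of_nat (\<Sum>j<m. j ^ n) = of_nat m * bernoulli n +
     (\<Sum>k=1..n. of_nat (n choose k) * bernoulli (n - k) * of_nat m ^ Suc k / of_nat (Suc k))"
  unfolding faulhaber atMost_atLeast0 by (subst sum.atLeast_Suc_atMost) auto

subsection \<open>Bernoulli numbers at a prime\<close>

text \<open>Solve Faulhaber's formula with m = p for its k = 0 term. In every other term one factor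
  \<open>p\<close> goes to \<open>bernoulli (n - k)\<close> by induction, and \<open>p ^ k\<close>
  absorbs \<open>Suc k\<close>.\<close>

lemma p_integral_prime_mult_bernoulli:
  assumes p: "prime p"
  shows "p_integral p (of_nat p * bernoulli n)"
proof (induction n rule: less_induct)
  case (less n)
  let ?f = "\<lambda>k. of_nat (n choose k) * bernoulli (n - k) * of_nat p ^ Suc k / of_nat (Suc k)"
  have "p_integral p (?f k)" if "k \<in> {1..n}" for k
  proof -
    have "p_integral p (of_nat (n choose k) * (of_nat p * bernoulli (n - k)) *
            (of_nat p ^ k / of_nat (Suc k)))"
      using that by (intro p_integral_mult p p_integral_of_nat less p_integral_power_div) auto
    thus ?thesis by (simp add: mult_ac)
  qed
  hence "p_integral p (of_nat (\<Sum>j<p. j ^ n) - sum ?f {1..n})"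
    by (intro p_integral_diff p_integral_sum p p_integral_of_nat)
  thus ?case unfolding faulhaber_tail by simp
qed

text \<open>After division by \<open>m\<close> the k-th term carries m^k. One factor
  \<open>p\<close> clears the denominator of the Bernoulli number, and the remaining p^(k-1) absorbs
  \<open>Suc k\<close> once k \<ge> 2.\<close>

lemma p_integral_power_sum_diff:
  assumes p: "prime p" "p dvd m" and n: "n > 0" "even n" and "m > 0"
  shows "p_integral p ((of_nat (power_sum n m) - of_nat m * bernoulli n) / of_nat m)"
proof -
  obtain m' where m': "m = p * m'" using p(2) by blast
  let ?f = "\<lambda>k. of_nat (n choose k) * bernoulli (n - k) * of_nat m ^ Suc k / of_nat (Suc k)"
  have "p_integral p (?f k / of_nat m)" if k: "k \<in> {1..n}" for k
  proof (cases "k = 1")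
    case True
    \<comment> \<open>No spare factor \<open>p\<close> is left for the denominator 2; the binomial
      coefficient n, being even, cancels it.\<close>
    have "p_integral p (of_nat (n div 2) * (of_nat m' * (of_nat p * bernoulli (n - 1))))"
      by (intro p_integral_mult p p_integral_of_nat p_integral_prime_mult_bernoulli)
    moreover have "(of_nat n :: rat) = 2 * of_nat (n div 2)"
      using n(2) by (metis dvd_mult_div_cancel of_nat_mult of_nat_numeral)
    ultimately show ?thesis
      using True \<open>m > 0\<close> m' by (simp add: field_simps power2_eq_square)
  next
    case False
    then obtain j where j: "k = Suc j" "j \<ge> 1" using k by (cases k) auto
    have "p_integral p (of_nat (n choose k) * (of_nat m' * (of_nat p * bernoulli (n - k))) *
            (of_nat (m' ^ j) * (of_nat p ^ j / of_nat (Suc k))))"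
      using j by (intro p_integral_mult p p_integral_of_nat p_integral_prime_mult_bernoulli
          p_integral_power_div) auto
    moreover have "?f k / of_nat m = of_nat (n choose k) * bernoulli (n - k) * of_nat m ^ k / of_nat (Suc k)"
      using \<open>m > 0\<close> by simp
    moreover have "(of_nat m :: rat) ^ k = of_nat m' * of_nat p * (of_nat (m' ^ j) * of_nat p ^ j)"
      by (simp add: m' j power_mult_distrib)
    ultimately show ?thesis
      by (simp only: mult_ac times_divide_eq_left times_divide_eq_right)
  qed
  hence "p_integral p (\<Sum>k=1..n. ?f k / of_nat m)"
    by (intro p_integral_sum p)
  thus ?thesis unfolding power_sum_eq [OF n(1)] faulhaber_tail
    by (simp add: sum_divide_distrib)
qed

text \<open>If p - 1 divides n, each of the p - 1 summands is 1 by Fermat. Otherwise a primitive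
  root turns the sum into a geometric one whose ratio is not 1 modulo \<open>p\<close>.\<close>

lemma power_sum_prime:
  assumes p: "prime p"
  shows "[int (power_sum n p) = (if p - 1 dvd n then -1 else 0)] (mod int p)"
proof (cases "p - 1 dvd n")
  case True
  have "[k ^ n = 1] (mod p)" if "k \<in> {1..p - 1}" for k
  proof -
    have "\<not> p dvd k" using that by (auto dest: dvd_imp_le)
    hence "[(k ^ (p - 1)) ^ (n div (p - 1)) = 1 ^ (n div (p - 1))] (mod p)"
      by (intro cong_pow fermat_theorem p)
    thus ?thesis using True by (simp flip: power_mult)
  qed
  hence "[power_sum n p = (\<Sum>k\<in>{1..p - 1}. 1)] (mod p)"
    unfolding power_sum_def by (rule cong_sum)
  hence "[int (power_sum n p) = int (p - 1)] (mod int p)"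
    by (simp add: cong_int_iff)
  also have "[int (p - 1) = -1] (mod int p)"
    using prime_gt_0_nat [OF p] by (simp add: of_nat_diff cong_iff_dvd_diff)
  finally show ?thesis using True by simp
next
  case False
  obtain g where g: "residue_primroot p g"
    using prime_primitive_root_exists [of p] p prime_gt_1_nat [OF p] by auto
  have tot: "totient p = p - 1" using p by (simp add: totient_prime)
  have ivl: "{0<..<p} = {1..p - 1}" by auto
  have bij: "bij_betw (\<lambda>i. g ^ i mod p) {..<p - 1} {1..p - 1}"
    using residue_primroot_is_generator [OF prime_gt_1_nat [OF p] g]
    unfolding tot totatives_prime [OF p] ivl .
  define h where "h = int (g ^ n)"
  have ord: "ord p g = p - 1" using g by (simp add: residue_primroot_def tot)
  have "power_sum n p = (\<Sum>i<p - 1. (g ^ i mod p) ^ n)"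
    unfolding power_sum_def by (rule sum.reindex_bij_betw [OF bij, symmetric])
  also have "[\<dots> = (\<Sum>i<p - 1. (g ^ n) ^ i)] (mod p)"
    by (intro cong_sum) (simp add: cong_def power_mod mult.commute flip: power_mult)
  finally have S: "[int (power_sum n p) = (\<Sum>i<p - 1. h ^ i)] (mod int p)"
    unfolding h_def by (simp flip: cong_int_iff)
  have "[g ^ (n * (p - 1)) = 1] (mod p)" by (simp only: ord_divides ord dvd_triv_right)
  hence "[h ^ (p - 1) = 1] (mod int p)"
    unfolding h_def by (metis cong_int_iff of_nat_1 of_nat_power power_mult)
  \<comment> \<open>The product equals h^(p-1) - 1.\<close>
  hence "int p dvd (h - 1) * (\<Sum>i<p - 1. h ^ i)"
    by (simp add: cong_iff_dvd_diff power_diff_1_eq)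
  \<comment> \<open>Since \<open>g\<close> has order p - 1, g^n is 1 modulo \<open>p\<close> only if
    p - 1 divides n.\<close>
  moreover have "\<not> int p dvd h - 1"
    using False ord_divides [of g n p] unfolding h_def ord
    by (metis cong_iff_dvd_diff cong_int_iff of_nat_1)
  ultimately have "int p dvd (\<Sum>i<p - 1. h ^ i)"
    using p by (simp add: prime_dvd_mult_iff)
  thus ?thesis using False cong_dvd_iff [OF cong_sym [OF S]] by (simp add: cong_0_iff)
qed

text \<open>The first congruence with m = p makes S_n(p)/p - B_n integral at \<open>p\<close>, and
  S_n(p) is known modulo \<open>p\<close>.\<close>

lemma von_staudt_clausen_local:
  assumes p: "prime p" and n: "n > 0" "even n"
  shows "p_integral p (bernoulli n + (if p - 1 dvd n then 1 / of_nat p else 0))"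
proof -
  define \<epsilon> :: int where "\<epsilon> = (if p - 1 dvd n then 1 else 0)"
  have "p > 0" using prime_gt_0_nat [OF p] .
  have "int p dvd int (power_sum n p) + \<epsilon>"
    using power_sum_prime [OF p, of n] by (auto simp: \<epsilon>_def cong_iff_dvd_diff split: if_splits)
  then obtain c where "int (power_sum n p) + \<epsilon> = int p * c" by blast
  hence "(of_int (int (power_sum n p) + \<epsilon>) :: rat) = of_int (int p * c)" by simp
  hence S: "of_nat (power_sum n p) = of_nat p * of_int c - (of_int \<epsilon> :: rat)" by simp
  have "p_integral p (of_int c - (of_nat (power_sum n p) - of_nat p * bernoulli n) / of_nat p)"
    by (intro p_integral_diff p p_integral_of_int p_integral_power_sum_diff n \<open>p > 0\<close>) auto
  moreover have "of_int c - (of_nat (power_sum n p) - of_nat p * bernoulli n) / of_nat p =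
      bernoulli n + of_int \<epsilon> / of_nat p"
    unfolding S using \<open>p > 0\<close> by (simp add: field_simps)
  ultimately have "p_integral p (bernoulli n + of_int \<epsilon> / of_nat p)"
    by simp
  thus ?thesis by (auto simp: \<epsilon>_def)
qed

section \<open>From single primes to the modulus \<open>m\<close>\<close>

lemma p_integral_inverse_prime:
  assumes "prime p" "prime q" "p \<noteq> q"
  shows "p_integral p (1 / of_nat q)"
  using assms primes_dvd_imp_eq [of p q] by (intro p_integralI [of p "int q" _ 1]) auto

theorem theorem1p2:
  fixes n m :: nat
  assumes "n > 0" and "m > 1" and "even n"
  shows "rat_cong (of_nat (power_sum n m)) (of_nat m * bernoulli n) m \<and>
         rat_cong (of_nat m * bernoulli n)
           (- (\<Sum>p | prime p \<and> p dvd m \<and> p - 1 dvd n. of_nat m / of_nat p)) m"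
proof
  have "m > 0" using assms(2) by simp
  show "rat_cong (of_nat (power_sum n m)) (of_nat m * bernoulli n) m"
    using \<open>m > 0\<close> p_integral_power_sum_diff [OF _ _ assms(1,3) \<open>m > 0\<close>] by (rule rat_congI)
  define P where "P = {p. prime p \<and> p dvd m \<and> p - 1 dvd n}"
  \<comment> \<open>Finiteness of \<open>P\<close> allows the summand at one prime to be split
    off.\<close>
  have "P \<subseteq> {d. d dvd m}" by (auto simp: P_def)
  hence fin: "finite P"
    using finite_divisors_nat [OF \<open>m > 0\<close>] by (rule finite_subset)
  have "rat_cong (of_nat m * bernoulli n) (- (\<Sum>p\<in>P. of_nat m / of_nat p)) m"
    using \<open>m > 0\<close>
  proof (rule rat_congI)
    fix p assume p: "prime p" "p dvd m"
    \<comment> \<open>The other primes contribute only terms integral at \<open>p\<close>, so the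
      summand 1/p alone has to match \<open>bernoulli n\<close>.\<close>
    let ?R = "\<Sum>q\<in>P - {p}. 1 / of_nat q :: rat"
    have R: "p_integral p ?R"
      using p(1) by (intro p_integral_sum p_integral_inverse_prime) (auto simp: P_def)
    have P_iff: "p \<in> P \<longleftrightarrow> p - 1 dvd n" using p by (simp add: P_def)
    have "(\<Sum>q\<in>P. 1 / of_nat q) = (if p - 1 dvd n then 1 / of_nat p else 0) + ?R"
      using sum.remove [OF fin, of p "\<lambda>q. 1 / of_nat q :: rat"] unfolding P_iff [symmetric] by simp
    moreover have "(of_nat m * bernoulli n - - (\<Sum>q\<in>P. of_nat m / of_nat q)) / of_nat m =
        bernoulli n + (\<Sum>q\<in>P. 1 / of_nat q)"
      using \<open>m > 0\<close> by (simp add: add_divide_distrib sum_divide_distrib)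
    ultimately have "(of_nat m * bernoulli n - - (\<Sum>q\<in>P. of_nat m / of_nat q)) / of_nat m =
        bernoulli n + (if p - 1 dvd n then 1 / of_nat p else 0) + ?R"
      by (simp only: add.assoc)
    thus "p_integral p ((of_nat m * bernoulli n - - (\<Sum>q\<in>P. of_nat m / of_nat q)) / of_nat m)"
      using p_integral_add [OF p(1) von_staudt_clausen_local [OF p(1) assms(1,3)] R]
      by (simp only:)
  qed
  thus "rat_cong (of_nat m * bernoulli n)
      (- (\<Sum>p | prime p \<and> p dvd m \<and> p - 1 dvd n. of_nat m / of_nat p)) m"
    unfolding P_def .
qed

end
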